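(* Let $n\ge1$ and let $P=S^n$ be the $n$-dimensional sphere. Then on the odd-dimensional sphere $S^{2n+1}$ there exists an exact $P$-function with two singularities (critical submanifolds).
   Context: **$P$-function.** Let $P$ be a fixed smooth manifold without boundary. A differentiable function on a manifold whose set of critical points is a disjoint union of smooth submanifolds without boundary is called a $P$-function if each of its critical submanifolds is homeomorphic to $P$. A $P$-function on a manifold is called **exact** if the number of its critical submanifolds equals the minimum, taken over all $P$-functions on the manifold, of the number of critical submanifolds. *)

theory Defs
  imports "HOL-Analysis.Analysis" "HOL-Library.Equipollence"
begin

text \<open>
  Manifolds are embedded submanifolds of a Euclidean space. Differentiable functions are taken
  to be of class \<open>C\<^sup>\<infinity>\<close>, the usual convention in differential topology.
\<close>

text \<open>The next two definitions are meant for open \<open>S\<close>.\<close>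

primrec Ck_on ::
  "nat \<Rightarrow> 'a::real_normed_vector set \<Rightarrow> ('a \<Rightarrow> 'b::real_normed_vector) \<Rightarrow> bool" where
  "Ck_on 0 S f \<longleftrightarrow> continuous_on S f"
| "Ck_on (Suc k) S f \<longleftrightarrow>
     (\<forall>x\<in>S. f differentiable (at x)) \<and> (\<forall>v. Ck_on k S (\<lambda>x. frechet_derivative f (at x) v))"

definition smooth_on ::
  "'a::real_normed_vector set \<Rightarrow> ('a \<Rightarrow> 'b::real_normed_vector) \<Rightarrow> bool" where
  "smooth_on S f \<longleftrightarrow> (\<forall>k. Ck_on k S f)"

text \<open>
  Slice charts: around each of its points, \<open>S\<close> is straightened to a \<open>k\<close>-dimensional linear
  subspace by a diffeomorphism of open subsets of the ambient space. In particular \<open>S\<close> has no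
  boundary. If \<open>S \<subseteq> M\<close> and \<open>M\<close> is itself such a submanifold, then \<open>S\<close> is a submanifold of \<open>M\<close>.
\<close>

definition smooth_submanifold :: "nat \<Rightarrow> 'a::euclidean_space set \<Rightarrow> bool" where
  "smooth_submanifold k S \<longleftrightarrow>
     (\<forall>p\<in>S. \<exists>U V L (\<phi> :: 'a \<Rightarrow> 'a) \<psi>.
        open U \<and> p \<in> U \<and> open V \<and> homeomorphism U V \<phi> \<psi> \<and> smooth_on U \<phi> \<and> smooth_on V \<psi> \<and>
        subspace L \<and> dim L = k \<and> \<phi> ` (U \<inter> S) = V \<inter> L)"

text \<open>The values of \<open>f\<close> outside \<open>M\<close> are irrelevant here and in all definitions below.\<close>

definition smooth_function_on :: "'a::euclidean_space set \<Rightarrow> ('a \<Rightarrow> real) \<Rightarrow> bool" where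
  "smooth_function_on M f \<longleftrightarrow>
     (\<forall>p\<in>M. \<exists>U F. open U \<and> p \<in> U \<and> smooth_on U F \<and> (\<forall>x\<in>U \<inter> M. F x = f x))"

text \<open>
  The differential of \<open>f\<close> at \<open>p\<close> sends the tangent vector represented by a smooth curve \<open>\<gamma>\<close> in
  \<open>M\<close> with \<open>\<gamma> 0 = p\<close> to the derivative of \<open>f \<circ> \<gamma>\<close> at \<open>0\<close>; the point is critical if the
  differential vanishes.
\<close>

definition critical_set :: "'a::euclidean_space set \<Rightarrow> ('a \<Rightarrow> real) \<Rightarrow> 'a set" where
  "critical_set M f =
     {p \<in> M. \<forall>\<gamma> \<epsilon>. \<epsilon> > 0 \<longrightarrow> smooth_on {-\<epsilon><..<\<epsilon>} \<gamma> \<longrightarrow> \<gamma> ` {-\<epsilon><..<\<epsilon>} \<subseteq> M \<longrightarrow> \<gamma> 0 = p \<longrightarrow>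
        ((f \<circ> \<gamma>) has_real_derivative 0) (at 0)}"

text \<open>
  \<open>P_function P M f \<C>\<close>: \<open>f\<close> is a \<open>P\<close>-function on \<open>M\<close> whose family of critical submanifolds is
  \<open>\<C>\<close>. The disjoint union is one of topological spaces, so every member of \<open>\<C>\<close> is open in the
  critical set; a mere partition would, for example, make a constant function on the 3-sphere a
  circle-function by way of the Hopf fibration. For connected nonempty \<open>P\<close> the family \<open>\<C>\<close> is
  thus the set of connected components of the critical set. Both \<open>P\<close> and \<open>M\<close> are meant to be
  smooth submanifolds; \<open>P\<close> matters only up to homeomorphism.
\<close>

definition P_function ::
  "'p::euclidean_space set \<Rightarrow> 'a::euclidean_space set \<Rightarrow> ('a \<Rightarrow> real) \<Rightarrow> 'a set set \<Rightarrow> bool" where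
  "P_function P M f \<C> \<longleftrightarrow>
     smooth_function_on M f \<and>
     \<Union>\<C> = critical_set M f \<and> disjoint \<C> \<and>
     (\<forall>C\<in>\<C>. openin (top_of_set (critical_set M f)) C \<and> (\<exists>k. smooth_submanifold k C) \<and>
        C homeomorphic P)"

text \<open>Minimality is stated by \<open>\<lesssim>\<close>, as a general \<open>M\<close> may force infinitely many members.\<close>

definition exact_P_function ::
  "'p::euclidean_space set \<Rightarrow> 'a::euclidean_space set \<Rightarrow> ('a \<Rightarrow> real) \<Rightarrow> 'a set set \<Rightarrow> bool" where
  "exact_P_function P M f \<C> \<longleftrightarrow>
     P_function P M f \<C> \<and> (\<forall>g \<D>. P_function P M g \<D> \<longrightarrow> \<C> \<lesssim> \<D>)"

end

theory Submission imports Defs begin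

text \<open>
  Split the coordinates of \<open>\<real>\<^bsup>2n+2\<^esup>\<close> into two blocks of size \<open>n + 1\<close> and let \<open>f\<close> be the sum of the
  squares of the coordinates in the first block. On the unit sphere \<open>f\<close> takes values in \<open>[0, 1]\<close>;
  it is \<open>1\<close> exactly where the second block vanishes and \<open>0\<close> exactly where the first one does. These
  two sets are \<open>n\<close>-spheres, and they consist of critical points because \<open>f\<close> is extremal there
  (\<open>extremum_in_critical_set\<close>). At any other point the tangential gradient has squared length
  \<open>4 f (1 - f) > 0\<close>, so there are no further critical points (\<open>critical_set_coord_sqnorm\<close>). That
  the two spheres are submanifolds is seen from one kind of chart, the inversion in a sphere
  centred on the unit sphere, which flattens the unit sphere to a hyperplane
  (\<open>smooth_submanifold_sphere_section\<close>).

  No \<open>S\<^sup>n\<close>-function \<open>g\<close> on the sphere can have a single critical submanifold \<open>X\<close>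
  (\<open>P_function_two_members\<close>). The maximum and the minimum of \<open>g\<close> would both lie on \<open>X\<close>. Since \<open>n \<ge> 1\<close>,
  \<open>X\<close> is connected, and \<open>g\<close> is constant on connected critical submanifolds
  (\<open>constant_on_connected_critical_submanifold\<close>). So maximum and minimum would agree, \<open>g\<close> would be
  constant, and \<open>X\<close> would be all of \<open>S\<^bsup>2n+1\<^esup>\<close>, which does not embed into \<open>S\<^sup>n\<close>.
\<close>

section \<open>Calculus of smooth maps\<close>

lemma Ck_on_cong:
  assumes "open S" "\<And>x. x \<in> S \<Longrightarrow> f x = g x" "Ck_on k S f"
  shows "Ck_on k S g"
  using assms(2,3)
proof (induction k arbitrary: f g)
  case 0
  then show ?case by (metis Ck_on.simps(1) continuous_on_cong)
next
  case (Suc k)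
  have D: "(g has_derivative frechet_derivative f (at x)) (at x)" if "x \<in> S" for x
    using Suc.prems that \<open>open S\<close>
    by (metis Ck_on.simps(2) frechet_derivative_works has_derivative_transform_within_open)
  then have eq: "frechet_derivative g (at x) = frechet_derivative f (at x)" if "x \<in> S" for x
    using that by (metis frechet_derivative_at)
  have "Ck_on k S (\<lambda>x. frechet_derivative g (at x) v)" for v
    by (rule Suc.IH[of "\<lambda>x. frechet_derivative f (at x) v"]) (use Suc.prems eq in auto)
  with D show ?case by (auto simp: differentiable_def)
qed

text \<open>
  Proving higher differentiability with a derivative in closed form avoids the Hilbert choice in
  \<open>frechet_derivative\<close>. The closure properties below follow by induction on the order, the
  derivative being built from maps of the next lower order.
\<close>

lemma Ck_on_SucI:
  assumes "open S" "\<And>x. x \<in> S \<Longrightarrow> (f has_derivative f' x) (at x)"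
    and "\<And>v. Ck_on k S (\<lambda>x. f' x v)"
  shows "Ck_on (Suc k) S f"
proof -
  have "Ck_on k S (\<lambda>x. frechet_derivative f (at x) v)" for v
    by (rule Ck_on_cong[OF \<open>open S\<close> _ assms(3)[of v]])
      (use assms(2) frechet_derivative_at in metis)
  with assms(2) show ?thesis by (auto simp: differentiable_def)
qed

lemma Ck_on_SucD:
  assumes "Ck_on (Suc k) S f"
  shows "x \<in> S \<Longrightarrow> (f has_derivative frechet_derivative f (at x)) (at x)"
    and "Ck_on k S (\<lambda>x. frechet_derivative f (at x) v)"
  using assms by (auto simp: frechet_derivative_works)

lemma Ck_on_Suc_imp: "Ck_on (Suc k) S f \<Longrightarrow> Ck_on k S f"
proof (induction k arbitrary: f)
  case 0
  then show ?case
    by (auto intro!: continuous_at_imp_continuous_on differentiable_imp_continuous_within)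
next
  case (Suc k)
  then show ?case by (metis Ck_on.simps(2))
qed

lemma Ck_on_const: "open S \<Longrightarrow> Ck_on k S (\<lambda>x. c)"
proof (induction k arbitrary: c)
  case (Suc k)
  show ?case
    by (rule Ck_on_SucI[OF Suc.prems has_derivative_const Suc.IH[OF Suc.prems]])
qed simp

lemma Ck_on_bounded_linear:
  assumes "bounded_linear f" "open S"
  shows "Ck_on k S f"
proof (cases k)
  case 0
  then show ?thesis using assms by (simp add: linear_continuous_on)
next
  case (Suc m)
  show ?thesis unfolding Suc
    by (rule Ck_on_SucI[OF \<open>open S\<close> bounded_linear_imp_has_derivative[OF assms(1)]
          Ck_on_const[OF \<open>open S\<close>]])
qed

lemma Ck_on_add:
  assumes "open S" "Ck_on k S f" "Ck_on k S g"
  shows "Ck_on k S (\<lambda>x. f x + g x)"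
  using assms(2,3)
proof (induction k arbitrary: f g)
  case 0
  then show ?case by (simp add: continuous_on_add)
next
  case (Suc k)
  show ?case
    by (rule Ck_on_SucI[OF \<open>open S\<close> has_derivative_add])
      (use Ck_on_SucD[OF Suc.prems(1)] Ck_on_SucD[OF Suc.prems(2)] Suc.IH in auto)
qed

text \<open>Products, multiplication by scalars and inner products are all instances.\<close>

lemma Ck_on_bilinear:
  assumes "bounded_bilinear b" "open S" "Ck_on k S f" "Ck_on k S g"
  shows "Ck_on k S (\<lambda>x. b (f x) (g x))"
  using assms(3,4)
proof (induction k arbitrary: f g)
  case 0
  then show ?case using bounded_bilinear.continuous_on[OF assms(1)] by simp
next
  case (Suc k)
  show ?case
  proof (rule Ck_on_SucI[OF \<open>open S\<close> bounded_bilinear.FDERIV[OF assms(1)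
          Ck_on_SucD(1)[OF Suc.prems(1)] Ck_on_SucD(1)[OF Suc.prems(2)]]])
    show "Ck_on k S (\<lambda>x. b (f x) (frechet_derivative g (at x) v)
        + b (frechet_derivative f (at x) v) (g x))" for v
      by (intro Ck_on_add[OF \<open>open S\<close>] Suc.IH Ck_on_Suc_imp[OF Suc.prems(1)]
          Ck_on_Suc_imp[OF Suc.prems(2)] Ck_on_SucD(2)[OF Suc.prems(1)] Ck_on_SucD(2)[OF Suc.prems(2)])
  qed
qed

lemma Ck_on_inverse:
  fixes f :: "'a::real_normed_vector \<Rightarrow> real"
  assumes "open S" "\<And>x. x \<in> S \<Longrightarrow> f x \<noteq> 0" "Ck_on k S f"
  shows "Ck_on k S (\<lambda>x. inverse (f x))"
  using assms(3)
proof (induction k)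
  case 0
  then show ?case using assms(2) by (auto intro!: continuous_on_inverse)
next
  case (Suc k)
  note mult = Ck_on_bilinear[OF bounded_bilinear_mult \<open>open S\<close>]
  show ?case
  proof (rule Ck_on_SucI[OF \<open>open S\<close> Deriv.has_derivative_inverse[OF assms(2)
          Ck_on_SucD(1)[OF Suc.prems]]])
    have inv: "Ck_on k S (\<lambda>x. inverse (f x))"
      by (rule Suc.IH[OF Ck_on_Suc_imp[OF Suc.prems]])
    have "Ck_on k S (\<lambda>x. (- 1) * (inverse (f x) * frechet_derivative f (at x) v * inverse (f x)))" for v
      by (intro mult inv Ck_on_const \<open>open S\<close> Ck_on_SucD(2)[OF Suc.prems])
    then show "Ck_on k S (\<lambda>x. - (inverse (f x) * frechet_derivative f (at x) v * inverse (f x)))" for v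
      by simp
  qed
qed

lemma Ck_on_compose_affine:
  assumes "bounded_linear h" "open T" "(\<lambda>x. a + h x) ` T \<subseteq> S" "Ck_on k S f"
  shows "Ck_on k T (\<lambda>x. f (a + h x))"
  using assms(4)
proof (induction k arbitrary: f)
  case 0
  have "continuous_on T (\<lambda>x. a + h x)"
    by (intro continuous_intros linear_continuous_on assms)
  with 0 show ?case
    using assms(3) by (auto intro: continuous_on_compose2)
next
  case (Suc k)
  show ?case
  proof (rule Ck_on_SucI[OF \<open>open T\<close>])
    fix x assume "x \<in> T"
    then have "a + h x \<in> S" using assms(3) by auto
    have "((\<lambda>x. a + h x) has_derivative h) (at x)"
      by (auto intro!: derivative_eq_intros bounded_linear_imp_has_derivative assms(1))
    from has_derivative_compose[OF this Ck_on_SucD(1)[OF Suc.prems \<open>a + h x \<in> S\<close>]]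
    show "((\<lambda>x. f (a + h x)) has_derivative (\<lambda>v. frechet_derivative f (at (a + h x)) (h v))) (at x)" .
  next
    show "Ck_on k T (\<lambda>x. frechet_derivative f (at (a + h x)) (h v))" for v
      by (rule Suc.IH[OF Ck_on_SucD(2)[OF Suc.prems]])
  qed
qed

lemma smooth_on_imp_differentiable:
  assumes "smooth_on S f" "x \<in> S"
  shows "f differentiable (at x)"
  using assms Ck_on.simps(2) unfolding smooth_on_def by metis

text \<open>The family of these curves is closed under differentiation.\<close>

lemma smooth_on_circle:
  assumes "open S"
  shows "smooth_on S (\<lambda>t::real. cos t *\<^sub>R u + sin t *\<^sub>R w)"
proof -
  have "Ck_on k S (\<lambda>t::real. cos t *\<^sub>R u + sin t *\<^sub>R w)" for k
  proof (induction k arbitrary: u w)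
    case 0
    show ?case by (auto intro!: continuous_intros)
  next
    case (Suc k)
    show ?case
    proof (rule Ck_on_SucI[OF \<open>open S\<close>])
      show "((\<lambda>t. cos t *\<^sub>R u + sin t *\<^sub>R w) has_derivative
          (\<lambda>v. cos t *\<^sub>R (v *\<^sub>R w) + sin t *\<^sub>R (- v *\<^sub>R u))) (at t)" for t
        by (auto intro!: derivative_eq_intros simp: algebra_simps)
      show "Ck_on k S (\<lambda>t. cos t *\<^sub>R (v *\<^sub>R w) + sin t *\<^sub>R (- v *\<^sub>R u))" for v
        by (rule Suc.IH)
    qed
  qed
  then show ?thesis by (simp add: smooth_on_def)
qed

section \<open>Critical points\<close>

lemma smooth_function_on_imp_continuous_on:
  assumes "smooth_function_on M f"
  shows "continuous_on M f"
  unfolding continuous_on_eq_continuous_within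
proof
  fix p assume "p \<in> M"
  then obtain U F where U: "open U" "p \<in> U" "smooth_on U F" "\<forall>x\<in>U \<inter> M. F x = f x"
    using assms unfolding smooth_function_on_def by meson
  have "continuous (at p within M) F"
    using differentiable_imp_continuous_within[OF smooth_on_imp_differentiable[OF U(3,2)]]
      continuous_at_imp_continuous_at_within by blast
  moreover have "\<forall>\<^sub>F x in at p within M. F x = f x"
    using U by (auto simp: eventually_at_topological)
  moreover have "F p = f p" using U \<open>p \<in> M\<close> by simp
  ultimately show "continuous (at p within M) f"
    unfolding continuous_within by (metis (mono_tags, lifting) tendsto_cong)
qed

text \<open>
  Along a curve through an extremum the function has a local extremum, so its derivative vanishes
  once it exists; it exists because \<open>f\<close> extends to a smooth function near \<open>p\<close>.
\<close>

lemma extremum_in_critical_set: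
  assumes f: "smooth_function_on M f" and p: "p \<in> M"
    and ext: "(\<forall>x\<in>M. f x \<le> f p) \<or> (\<forall>x\<in>M. f p \<le> f x)"
  shows "p \<in> critical_set M f"
  unfolding critical_set_def
proof (intro CollectI conjI allI impI p)
  fix \<gamma> :: "real \<Rightarrow> 'a" and \<epsilon> :: real
  assume \<gamma>: "\<epsilon> > 0" "smooth_on {-\<epsilon><..<\<epsilon>} \<gamma>" "\<gamma> ` {-\<epsilon><..<\<epsilon>} \<subseteq> M" "\<gamma> 0 = p"
  obtain U F where U: "open U" "p \<in> U" "smooth_on U F" "\<forall>x\<in>U \<inter> M. F x = f x"
    using f p unfolding smooth_function_on_def by meson
  have d\<gamma>: "\<gamma> differentiable (at 0)"
    using smooth_on_imp_differentiable[OF \<gamma>(2)] \<open>\<epsilon> > 0\<close> by simp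
  have "F differentiable (at (\<gamma> 0))"
    using smooth_on_imp_differentiable[OF U(3)] U \<gamma> by simp
  with d\<gamma> have "(F \<circ> \<gamma>) differentiable (at 0)"
    by (metis differentiable_chain_at)
  then obtain l where l: "((F \<circ> \<gamma>) has_real_derivative l) (at 0)"
    by (auto simp: real_differentiable_def)
  have "\<forall>\<^sub>F t in at 0. \<gamma> t \<in> U"
    using differentiable_imp_continuous_within[OF d\<gamma>] U \<gamma>
    by (auto simp: continuous_within intro: topological_tendstoD)
  then obtain d where d: "d > 0" "\<And>t. t \<noteq> 0 \<Longrightarrow> \<bar>t\<bar> < d \<Longrightarrow> \<gamma> t \<in> U"
    by (auto simp: eventually_at dist_real_def)
  define e where "e = min d \<epsilon>"
  have e: "e > 0" "\<And>t. \<bar>t\<bar> < e \<Longrightarrow> \<gamma> t \<in> U \<inter> M"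
  proof -
    show "e > 0" using d \<gamma> by (simp add: e_def)
    show "\<gamma> t \<in> U \<inter> M" if "\<bar>t\<bar> < e" for t
      using that d(2)[of t] U(2) \<gamma>(3,4) by (cases "t = 0") (auto simp: e_def image_subset_iff abs_less_iff)
  qed
  have fl: "((f \<circ> \<gamma>) has_real_derivative l) (at 0)"
  proof (rule has_field_derivative_transform_within_open[OF l, of "{-e<..<e}"])
    show "(F \<circ> \<gamma>) t = (f \<circ> \<gamma>) t" if "t \<in> {-e<..<e}" for t
      using e(2)[of t] that U(4) by auto
  qed (use e in auto)
  have in_M: "\<gamma> t \<in> M" if "\<bar>0 - t\<bar> < e" for t using e(2)[of t] that by auto
  have "l = 0"
    using ext
  proof
    assume "\<forall>x\<in>M. f x \<le> f p"
    then show ?thesis using in_M \<gamma>(4) by (intro DERIV_local_max[OF fl e(1)]) auto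
  next
    assume "\<forall>x\<in>M. f p \<le> f x"
    then show ?thesis using in_M \<gamma>(4) by (intro DERIV_local_min[OF fl e(1)]) auto
  qed
  with fl show "((f \<circ> \<gamma>) has_real_derivative 0) (at 0)" by simp
qed

text \<open>
  Reparametrised to start at any of its points, the curve is a test curve for criticality at that
  point, so the derivative of \<open>f\<close> along it vanishes throughout. The slack \<open>\<delta>\<close> provides the open
  parameter interval that a test curve needs at the two end points.
\<close>

lemma constant_along_critical_curve:
  fixes c :: "real \<Rightarrow> 'a::euclidean_space"
  assumes "a \<le> b" "\<delta> > 0" and c: "smooth_on {a - \<delta><..<b + \<delta>} c"
    and crit: "c ` {a - \<delta><..<b + \<delta>} \<subseteq> critical_set M f"
  shows "f (c a) = f (c b)"
proof -
  have D: "((f \<circ> c) has_real_derivative 0) (at s)" if s: "a \<le> s" "s \<le> b" for s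
  proof -
    have sub: "(\<lambda>t. s + t) ` {-\<delta><..<\<delta>} \<subseteq> {a - \<delta><..<b + \<delta>}"
      using s by auto
    have "smooth_on {-\<delta><..<\<delta>} (\<lambda>t. c (s + t))"
      using c unfolding smooth_on_def
      by (intro allI Ck_on_compose_affine[OF bounded_linear_ident _ sub]) auto
    moreover have "(\<lambda>t. c (s + t)) ` {-\<delta><..<\<delta>} \<subseteq> M"
      using crit sub unfolding critical_set_def by blast
    moreover have "c s \<in> critical_set M f"
      using crit s \<open>\<delta> > 0\<close> by (auto simp: image_subset_iff)
    ultimately have "((f \<circ> (\<lambda>t. c (s + t))) has_real_derivative 0) (at 0)"
      using \<open>\<delta> > 0\<close> unfolding critical_set_def by auto
    then show ?thesis
      using DERIV_shift[of "f \<circ> c" 0 0 s] by (simp add: o_def add.commute)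
  qed
  show ?thesis
  proof (cases "a < b")
    case True
    have "continuous_on {a..b} (f \<circ> c)"
      using D by (meson DERIV_continuous atLeastAtMost_iff continuous_at_imp_continuous_on)
    from DERIV_isconst_end[OF True this] D show ?thesis by simp
  qed (use \<open>a \<le> b\<close> in simp)
qed

text \<open>
  In a slice chart nearby points of \<open>C\<close> are joined by a segment of the linear slice. The inverse
  chart turns it into a smooth curve of critical points, so \<open>f\<close> is locally constant.
\<close>

lemma constant_on_connected_critical_submanifold:
  fixes C :: "'a::euclidean_space set"
  assumes C: "smooth_submanifold k C" "connected C" and crit: "C \<subseteq> critical_set M f"
  shows "f constant_on C"
proof (rule locally_constant_imp_constant[OF \<open>connected C\<close>])
  fix p assume "p \<in> C"
  from bspec[OF C(1)[unfolded smooth_submanifold_def] this]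
  obtain U V L and \<phi> \<psi> :: "'a \<Rightarrow> 'a" where ch: "homeomorphism U V \<phi> \<psi>" "open U" "p \<in> U"
    "open V" "smooth_on V \<psi>" "subspace L" "\<phi> ` (U \<inter> C) = V \<inter> L"
    by (elim exE conjE) (rule that)
  have "\<phi> p \<in> V" using homeomorphism_image1[OF ch(1)] ch(3) by blast
  then obtain e where e: "e > 0" "ball (\<phi> p) e \<subseteq> V" using ch(4) openE by blast
  have psi_in: "\<psi> y \<in> C" if "y \<in> V" "y \<in> L" for y
  proof -
    from that have "y \<in> \<phi> ` (U \<inter> C)" by (simp add: ch(7))
    then obtain x where "x \<in> U" "x \<in> C" "\<phi> x = y" by auto
    then show ?thesis using homeomorphism_apply1[OF ch(1)] by metis
  qed
  define T where "T = C \<inter> (U \<inter> \<phi> -` ball (\<phi> p) e)"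
  have "open (U \<inter> \<phi> -` ball (\<phi> p) e)"
    using homeomorphism_cont1[OF ch(1)] ch(2) by (rule continuous_open_preimage[OF _ _ open_ball])
  then have "openin (top_of_set C) T"
    unfolding T_def by (rule openin_open_Int)
  moreover have "p \<in> T" using \<open>p \<in> C\<close> ch(3) e(1) by (simp add: T_def)
  moreover have "f q = f p" if "q \<in> T" for q
  proof -
    define w where "w = \<phi> q - \<phi> p"
    have "norm w < e" using that by (auto simp: T_def w_def dist_norm norm_minus_commute)
    have "\<phi> x \<in> L" if "x \<in> U \<inter> C" for x using imageI[OF that, of \<phi>] ch(7) by simp
    then have pqL: "\<phi> p \<in> L" "\<phi> q \<in> L" using ch(3) that \<open>p \<in> C\<close> by (auto simp: T_def)
    \<comment> \<open>The room left in the ball lets the segment be prolonged a little at both ends.\<close>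
    obtain \<delta> where \<delta>: "\<delta> > 0" "(1 + \<delta>) * norm w < e"
    proof
      show "(e - norm w) / (e + norm w) > 0" using \<open>norm w < e\<close> e(1) by (intro divide_pos_pos add_pos_nonneg) auto
      have "e + norm w > 0" using e(1) by (intro add_pos_nonneg) auto
      moreover have "2 * e * norm w < e * (e + norm w)"
        using \<open>norm w < e\<close> e(1) by (simp add: algebra_simps)
      ultimately show "(1 + (e - norm w) / (e + norm w)) * norm w < e"
        by (simp add: field_simps)
    qed
    have seg: "\<phi> p + t *\<^sub>R w \<in> V \<inter> L" if "t \<in> {0 - \<delta><..<1 + \<delta>}" for t
    proof
      have "\<bar>t\<bar> * norm w \<le> (1 + \<delta>) * norm w"
        using that by (intro mult_right_mono) auto
      then have "norm (t *\<^sub>R w) < e" using \<delta>(2) by simp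
      then show "\<phi> p + t *\<^sub>R w \<in> V" using e(2) by (auto simp: dist_norm)
      show "\<phi> p + t *\<^sub>R w \<in> L"
        unfolding w_def using pqL ch(6) by (simp add: subspace_add subspace_diff subspace_scale)
    qed
    have "smooth_on {0 - \<delta><..<1 + \<delta>} (\<lambda>t. \<psi> (\<phi> p + t *\<^sub>R w))"
      using ch(5) seg unfolding smooth_on_def
      by (intro allI Ck_on_compose_affine[where S = V] bounded_linear_scaleR_left) auto
    moreover have "(\<lambda>t. \<psi> (\<phi> p + t *\<^sub>R w)) ` {0 - \<delta><..<1 + \<delta>} \<subseteq> critical_set M f"
      using seg psi_in crit by blast
    ultimately have "f (\<psi> (\<phi> p + 0 *\<^sub>R w)) = f (\<psi> (\<phi> p + 1 *\<^sub>R w))"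
      by (rule constant_along_critical_curve[OF zero_le_one \<delta>(1)])
    then show ?thesis
      using homeomorphism_apply1[OF ch(1)] ch(3) that by (simp add: w_def T_def)
  qed
  ultimately show "\<exists>T. openin (top_of_set C) T \<and> p \<in> T \<and> (\<forall>x\<in>T. f x = f p)" by blast
qed

text \<open>The test curves are the great circles through \<open>p\<close>.\<close>

lemma derivative_zero_on_tangent_sphere:
  fixes p q :: "'a::euclidean_space"
  assumes crit: "p \<in> critical_set (sphere 0 1) f"
    and f: "(f has_derivative f') (at p)" and "p \<bullet> q = 0"
  shows "f' q = 0"
proof -
  have unit: "f' u = 0" if u: "norm u = 1" "p \<bullet> u = 0" for u
  proof -
    define \<gamma> where "\<gamma> = (\<lambda>t::real. cos t *\<^sub>R p + sin t *\<^sub>R u)"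
    have "norm p = 1" using crit by (simp add: critical_set_def)
    have "\<gamma> t \<bullet> \<gamma> t = 1" for t
    proof -
      have "\<gamma> t \<bullet> \<gamma> t = (cos t)\<^sup>2 * (p \<bullet> p) + (sin t)\<^sup>2 * (u \<bullet> u)"
        using u(2) by (simp add: \<gamma>_def inner_add_left inner_add_right inner_commute power2_eq_square)
      also have "\<dots> = 1" using u(1) \<open>norm p = 1\<close> by (simp add: dot_square_norm)
      finally show ?thesis .
    qed
    then have sub: "\<gamma> ` {-1<..<1} \<subseteq> sphere 0 1" by (auto simp: norm_eq_1)
    have sm: "smooth_on {-1<..<1} \<gamma>" unfolding \<gamma>_def by (rule smooth_on_circle) simp
    have "((f \<circ> \<gamma>) has_real_derivative 0) (at 0)"
    proof -
      have "\<gamma> 0 = p" by (simp add: \<gamma>_def)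
      moreover have "(1::real) > 0" by simp
      ultimately show ?thesis using crit sm sub unfolding critical_set_def by blast
    qed
    moreover have "((f \<circ> \<gamma>) has_derivative (\<lambda>t. f' (t *\<^sub>R u))) (at 0)"
    proof -
      have "(\<gamma> has_derivative (\<lambda>t. t *\<^sub>R u)) (at 0)"
        unfolding \<gamma>_def by (auto intro!: derivative_eq_intros)
      moreover have "\<gamma> 0 = p" by (simp add: \<gamma>_def)
      ultimately show ?thesis
        using has_derivative_compose[of \<gamma> "\<lambda>t. t *\<^sub>R u" 0 UNIV f f'] f by (simp add: o_def)
    qed
    ultimately have "(\<lambda>t. f' (t *\<^sub>R u)) = (\<lambda>t. 0 * t)"
      unfolding has_field_derivative_def by (rule has_derivative_unique[rotated])
    then show ?thesis by (metis mult_zero_left scaleR_one)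
  qed
  have lin: "linear f'" using f has_derivative_linear by blast
  show ?thesis
  proof (cases "q = 0")
    case True
    then show ?thesis using lin by (simp add: linear_0)
  next
    case False
    then have "f' ((1 / norm q) *\<^sub>R q) = 0" using \<open>p \<bullet> q = 0\<close> by (intro unit) auto
    with False show ?thesis using lin by (simp add: linear_cmul)
  qed
qed

section \<open>Linear sections of the unit sphere\<close>

text \<open>
  The radius is \<open>\<surd>2\<close>: then, for a centre \<open>c\<close> on the unit sphere, the image of the unit sphere is the
  hyperplane orthogonal to \<open>c\<close> through the origin, so that the flattened sphere is a linear and not
  just an affine subspace.
\<close>

definition inversion :: "'a::real_inner \<Rightarrow> 'a \<Rightarrow> 'a" where
  "inversion c x = c + (2 * inverse ((x - c) \<bullet> (x - c))) *\<^sub>R (x - c)"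

lemma inversion_diff_inner:
  assumes "x \<noteq> c"
  shows "(inversion c x - c) \<bullet> (inversion c x - c) = 4 * inverse ((x - c) \<bullet> (x - c))"
proof -
  define r where "r = (x - c) \<bullet> (x - c)"
  have "r \<noteq> 0" using assms by (simp add: r_def)
  have "(inversion c x - c) \<bullet> (inversion c x - c) = (2 * inverse r) * ((2 * inverse r) * r)"
    by (simp add: inversion_def r_def[symmetric])
  also have "\<dots> = 4 * inverse r" using \<open>r \<noteq> 0\<close> by (simp add: field_simps)
  finally show ?thesis by (simp add: r_def)
qed

lemma inversion_neq: "x \<noteq> c \<Longrightarrow> inversion c x \<noteq> c"
  by (simp add: inversion_def)

lemma inversion_inversion:
  assumes "x \<noteq> c"
  shows "inversion c (inversion c x) = x"
proof -
  let ?r = "(x - c) \<bullet> (x - c)"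
  have "inversion c (inversion c x) = c + (2 * inverse (4 * inverse ?r)) *\<^sub>R (inversion c x - c)"
    using inversion_diff_inner[OF assms] by (simp add: inversion_def[of c "inversion c x"])
  also have "\<dots> = c + (2 * inverse (4 * inverse ?r) * (2 * inverse ?r)) *\<^sub>R (x - c)"
    by (simp add: inversion_def)
  also have "2 * inverse (4 * inverse ?r) * (2 * inverse ?r) = 1"
    using assms by (simp add: field_simps)
  finally show ?thesis by simp
qed

lemma smooth_on_inversion: "smooth_on (- {c}) (inversion c)"
proof -
  have S: "open (- {c})" by auto
  have "Ck_on k (- {c}) (inversion c)" for k
  proof -
    have sub: "Ck_on k (- {c}) (\<lambda>x. x + - c)"
      by (intro Ck_on_add Ck_on_const Ck_on_bounded_linear bounded_linear_ident S)
    have "Ck_on k (- {c}) (\<lambda>x. c + (2 * inverse ((x + - c) \<bullet> (x + - c))) *\<^sub>R (x + - c))"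
      by (intro Ck_on_add Ck_on_const Ck_on_bilinear[OF bounded_bilinear_scaleR]
          Ck_on_bilinear[OF bounded_bilinear_mult] Ck_on_inverse
          Ck_on_bilinear[OF bounded_bilinear_inner] sub S) auto
    then show ?thesis by (simp add: inversion_def[abs_def])
  qed
  then show ?thesis by (simp add: smooth_on_def)
qed

lemma inversion_in_subspace:
  assumes "subspace W" "c \<in> W" "x \<in> W"
  shows "inversion c x \<in> W"
  using assms by (simp add: inversion_def subspace_add subspace_diff subspace_scale)

lemma inversion_sphere_iff:
  assumes "norm c = 1" "x \<noteq> c"
  shows "c \<bullet> inversion c x = 0 \<longleftrightarrow> norm x = 1"
proof -
  have c: "c \<bullet> c = 1" using assms(1) by (simp add: norm_eq_1)
  define r where "r = (x - c) \<bullet> (x - c)"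
  have r: "r \<noteq> 0" "r = x \<bullet> x - 2 * (c \<bullet> x) + 1"
  proof -
    show "r \<noteq> 0" using assms(2) by (simp add: r_def)
    show "r = x \<bullet> x - 2 * (c \<bullet> x) + 1"
      using c by (simp add: r_def inner_diff_left inner_diff_right inner_commute)
  qed
  have "c \<bullet> inversion c x = c \<bullet> c + 2 * inverse r * (c \<bullet> x - c \<bullet> c)"
    unfolding inversion_def r_def[symmetric]
    by (simp only: inner_add_right inner_scaleR_right inner_diff_right)
  also have "\<dots> = (r + 2 * (c \<bullet> x - 1)) / r"
    using r(1) c by (simp add: field_simps)
  also have "r + 2 * (c \<bullet> x - 1) = x \<bullet> x - 1"
    using r(2) by simp
  finally show ?thesis using r(1) by (simp add: norm_eq_1)
qed

text \<open>
  Inversion centred at \<open>-p\<close> is a chart around \<open>p\<close>. It is its own inverse, it preserves \<open>W\<close> since its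
  centre lies in \<open>W\<close>, and it takes the unit sphere to a hyperplane.
\<close>

lemma smooth_submanifold_sphere_section:
  fixes W :: "'a::euclidean_space set"
  assumes W: "subspace W"
  shows "smooth_submanifold (dim W - 1) (sphere 0 1 \<inter> W)"
  unfolding smooth_submanifold_def
proof
  fix p assume p: "p \<in> sphere 0 1 \<inter> W"
  define c where "c = - p"
  have c: "norm c = 1" "c \<in> W" "p \<noteq> c"
  proof -
    show "norm c = 1" "c \<in> W" using p W by (auto simp: c_def subspace_neg)
    have "p \<bullet> p = 1" "p \<bullet> c = - 1" using p by (auto simp: c_def norm_eq_1)
    then show "p \<noteq> c" by auto
  qed
  let ?U = "- {c}" and ?i = "inversion c"
  define L where "L = W \<inter> {x. c \<bullet> x = 0}"
  have cont: "continuous_on ?U ?i"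
    using smooth_on_inversion[of c] unfolding smooth_on_def by (metis Ck_on.simps(1))
  have img: "?i ` ?U = ?U"
  proof
    show "?i ` ?U \<subseteq> ?U" using inversion_neq by fast
    show "?U \<subseteq> ?i ` ?U"
      using inversion_inversion inversion_neq by (metis ComplD ComplI image_eqI singletonD singletonI subsetI)
  qed
  have hom: "homeomorphism ?U ?U ?i ?i"
    unfolding homeomorphism_def using cont img inversion_inversion by auto
  have eq: "?i ` (?U \<inter> (sphere 0 1 \<inter> W)) = ?U \<inter> L"
  proof
    show "?i ` (?U \<inter> (sphere 0 1 \<inter> W)) \<subseteq> ?U \<inter> L"
      using inversion_neq[of _ c, THEN not_sym] inversion_in_subspace[OF W c(2)] inversion_sphere_iff[OF c(1)]
      by (auto simp: L_def)
    show "?U \<inter> L \<subseteq> ?i ` (?U \<inter> (sphere 0 1 \<inter> W))"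
    proof
      fix y assume y: "y \<in> ?U \<inter> L"
      then have y': "y \<noteq> c" "y \<in> W" "c \<bullet> y = 0" by (auto simp: L_def)
      have "norm (?i y) = 1"
        using inversion_sphere_iff[OF c(1) inversion_neq[OF y'(1)]] y' inversion_inversion by metis
      moreover have "?i y \<in> W" "?i y \<noteq> c" "?i (?i y) = y"
        using y' inversion_in_subspace[OF W c(2)] inversion_neq inversion_inversion by metis+
      ultimately show "y \<in> ?i ` (?U \<inter> (sphere 0 1 \<inter> W))" by (intro image_eqI[of _ _ "?i y"]) auto
    qed
  qed
  have L: "subspace L" unfolding L_def by (intro subspace_inter W subspace_hyperplane)
  have dimL: "dim L = dim W - 1"
  proof -
    have "dim {y \<in> W. \<forall>x\<in>span {c}. orthogonal x y} + dim (span {c}) = dim W"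
      by (intro dim_subspace_orthogonal_to_vectors subspace_span W span_minimal) (use c in auto)
    moreover have "{y \<in> W. \<forall>x\<in>span {c}. orthogonal x y} = L"
      by (auto simp: L_def span_singleton orthogonal_def)
    moreover have "dim (span {c}) = 1" using c(1) by (subst dim_span) (auto simp: dim_singleton)
    ultimately show ?thesis by simp
  qed
  show "\<exists>U V L (\<phi> :: 'a \<Rightarrow> 'a) \<psi>. open U \<and> p \<in> U \<and> open V \<and> homeomorphism U V \<phi> \<psi> \<and>
      smooth_on U \<phi> \<and> smooth_on V \<psi> \<and> subspace L \<and> dim L = dim W - 1 \<and>
      \<phi> ` (U \<inter> (sphere 0 1 \<inter> W)) = V \<inter> L"
    by (rule exI[of _ ?U], rule exI[of _ ?U], rule exI[of _ L], rule exI[of _ ?i], rule exI[of _ ?i])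
      (use hom eq L dimL smooth_on_inversion[of c] \<open>p \<noteq> c\<close> in auto)
qed

lemma homeomorphic_sphere_section:
  fixes W :: "'b::euclidean_space set"
  assumes W: "subspace W" and dim: "dim W = DIM('a::euclidean_space)"
  shows "(sphere 0 1 \<inter> W) homeomorphic (sphere (0::'a) 1)"
proof -
  obtain f g where fg: "linear f" "linear g" "f ` W = (UNIV::'a set)" "g ` (UNIV::'a set) = W"
    "\<And>x. x \<in> W \<Longrightarrow> norm (f x) = norm x" "\<And>x. x \<in> (UNIV::'a set) \<Longrightarrow> norm (g x) = norm x"
    "\<And>x. x \<in> W \<Longrightarrow> g (f x) = x" "\<And>x. x \<in> (UNIV::'a set) \<Longrightarrow> f (g x) = x"
    using isometries_subspaces[OF W subspace_UNIV] dim by (metis dim_UNIV)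
  have "homeomorphism (sphere 0 1 \<inter> W) (sphere 0 1) f g"
    unfolding homeomorphism_def
  proof (intro conjI)
    show "continuous_on (sphere 0 1 \<inter> W) f" "continuous_on (sphere 0 1) g"
      using fg(1,2) by (auto intro: linear_continuous_on simp: linear_conv_bounded_linear)
    have gW: "g y \<in> W" for y using fg(4) by blast
    show "f ` (sphere 0 1 \<inter> W) = sphere 0 1"
    proof
      show "f ` (sphere 0 1 \<inter> W) \<subseteq> sphere 0 1" using fg(5) by auto
      show "sphere 0 1 \<subseteq> f ` (sphere 0 1 \<inter> W)"
      proof
        fix y :: 'a assume "y \<in> sphere 0 1"
        then show "y \<in> f ` (sphere 0 1 \<inter> W)"
          using fg(6,8) gW by (intro image_eqI[of _ _ "g y"]) auto
      qed
    qed
    show "g ` sphere 0 1 = sphere 0 1 \<inter> W"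
    proof
      show "g ` sphere 0 1 \<subseteq> sphere 0 1 \<inter> W" using fg(6) gW by auto
      show "sphere 0 1 \<inter> W \<subseteq> g ` sphere 0 1"
      proof
        fix x assume "x \<in> sphere 0 1 \<inter> W"
        then show "x \<in> g ` sphere 0 1"
          using fg(5,7) by (intro image_eqI[of _ _ "f x"]) auto
      qed
    qed
  qed (use fg in auto)
  then show ?thesis unfolding homeomorphic_def by blast
qed

section \<open>Partial sums of squares of coordinates\<close>

definition coord_subspace :: "'a::euclidean_space set \<Rightarrow> 'a set" where
  "coord_subspace D = {x. \<forall>i\<in>Basis. i \<notin> D \<longrightarrow> x \<bullet> i = 0}"

definition coord_sqnorm :: "'a::euclidean_space set \<Rightarrow> 'a \<Rightarrow> real" where
  "coord_sqnorm D x = (\<Sum>i\<in>D. (x \<bullet> i)\<^sup>2)"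

lemma has_derivative_coord_sqnorm:
  "(coord_sqnorm D has_derivative (\<lambda>v. \<Sum>i\<in>D. 2 * (x \<bullet> i) * (v \<bullet> i))) (at x)"
  unfolding coord_sqnorm_def[abs_def]
  by (auto intro!: derivative_eq_intros sum.cong)

lemma smooth_on_coord_sqnorm: "smooth_on UNIV (coord_sqnorm D)"
proof -
  have "Ck_on k UNIV (coord_sqnorm D)" for k
  proof (cases k)
    case 0
    then show ?thesis
      using has_derivative_continuous[OF has_derivative_coord_sqnorm]
      by (simp, intro continuous_at_imp_continuous_on ballI)
  next
    case (Suc m)
    have "bounded_linear (\<lambda>x. \<Sum>i\<in>D. 2 * (x \<bullet> i) * (v \<bullet> i))" for v
      by (intro bounded_linear_sum bounded_linear_mult_const bounded_linear_const_mult
          bounded_linear_inner_left)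
    then show ?thesis unfolding Suc
      by (intro Ck_on_SucI[OF _ has_derivative_coord_sqnorm] Ck_on_bounded_linear) auto
  qed
  then show ?thesis by (simp add: smooth_on_def)
qed

lemma coord_sqnorm_nonneg: "coord_sqnorm D x \<ge> 0"
  by (simp add: coord_sqnorm_def sum_nonneg)

lemma coord_sqnorm_complement:
  assumes "D \<subseteq> Basis"
  shows "coord_sqnorm D x + coord_sqnorm (Basis - D) x = (norm x)\<^sup>2"
proof -
  have "(norm x)\<^sup>2 = x \<bullet> x" by (rule power2_norm_eq_inner)
  also have "\<dots> = (\<Sum>i\<in>Basis. (x \<bullet> i)\<^sup>2)"
    by (subst euclidean_inner) (simp add: power2_eq_square)
  also have "\<dots> = coord_sqnorm D x + coord_sqnorm (Basis - D) x"
    unfolding coord_sqnorm_def using assms by (simp add: sum.subset_diff add.commute)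
  finally show ?thesis by simp
qed

lemma coord_sqnorm_eq_0_iff:
  assumes "D \<subseteq> Basis"
  shows "coord_sqnorm D x = 0 \<longleftrightarrow> x \<in> coord_subspace (Basis - D)"
proof -
  have "finite D" using finite_subset[OF assms finite_Basis] .
  then show ?thesis
    unfolding coord_sqnorm_def coord_subspace_def using assms by (auto simp: sum_nonneg_eq_0_iff)
qed

lemma coord_sqnorm_eq_1_iff:
  assumes "D \<subseteq> Basis" "norm x = 1"
  shows "coord_sqnorm D x = 1 \<longleftrightarrow> x \<in> coord_subspace D"
proof -
  have "Basis - (Basis - D) = D" using assms(1) by auto
  then have "x \<in> coord_subspace D \<longleftrightarrow> coord_sqnorm (Basis - D) x = 0"
    using coord_sqnorm_eq_0_iff[of "Basis - D" x] by auto
  then show ?thesis using coord_sqnorm_complement[OF assms(1), of x] assms(2) by auto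
qed

text \<open>
  Write \<open>s\<close> for the value at \<open>p\<close> and \<open>a\<close> for the projection of \<open>p\<close> to the coordinates in \<open>D\<close>. Then
  \<open>q = a - s p\<close> is tangent to the sphere at \<open>p\<close>, and the derivative at \<open>p\<close> in this direction is
  \<open>2 s (1 - s)\<close>. So a critical value is \<open>0\<close> or \<open>1\<close>. Conversely a point with such a value is an
  extremum, as all values lie in \<open>[0, 1]\<close>.
\<close>

lemma critical_set_coord_sqnorm:
  assumes D: "D \<subseteq> (Basis :: 'a::euclidean_space set)"
  shows "critical_set (sphere 0 1) (coord_sqnorm D) =
    (sphere 0 1 \<inter> coord_subspace D) \<union> (sphere 0 1 \<inter> coord_subspace (Basis - D))"
proof -
  have le1: "coord_sqnorm D x \<le> 1" if "norm x = 1" for x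
    using coord_sqnorm_complement[OF D, of x] coord_sqnorm_nonneg[of "Basis - D" x] that by simp
  have "p \<in> critical_set (sphere 0 1) (coord_sqnorm D) \<longleftrightarrow>
      coord_sqnorm D p = 1 \<or> coord_sqnorm D p = 0" if p: "norm p = 1" for p
  proof
    assume crit: "p \<in> critical_set (sphere 0 1) (coord_sqnorm D)"
    define s where "s = coord_sqnorm D p"
    define a where "a = (\<Sum>i\<in>D. (p \<bullet> i) *\<^sub>R i)"
    \<comment> \<open>The tangential part of \<open>a\<close>; since \<open>2 a\<close> is the gradient in the ambient space, this is half the
        gradient on the sphere.\<close>
    define q where "q = a - s *\<^sub>R p"
    have fin: "finite D" using finite_subset[OF D finite_Basis] .
    have a_i: "a \<bullet> i = p \<bullet> i" if "i \<in> D" for i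
    proof -
      have "a \<bullet> i = (\<Sum>j\<in>D. if j = i then p \<bullet> i else 0)"
        unfolding a_def inner_sum_left
        by (rule sum.cong) (use subsetD[OF D] that in \<open>auto simp: inner_Basis\<close>)
      then show ?thesis using fin that by simp
    qed
    have pa: "p \<bullet> a = s"
      by (simp add: a_def s_def coord_sqnorm_def inner_sum_right power2_eq_square)
    have pq: "p \<bullet> q = 0"
      using p by (simp add: q_def inner_diff_right pa norm_eq_1)
    have "(\<Sum>i\<in>D. 2 * (p \<bullet> i) * (q \<bullet> i)) = 0"
      by (rule derivative_zero_on_tangent_sphere[OF crit has_derivative_coord_sqnorm pq])
    moreover have "(\<Sum>i\<in>D. 2 * (p \<bullet> i) * (q \<bullet> i)) = (\<Sum>i\<in>D. 2 * (1 - s) * (p \<bullet> i)\<^sup>2)"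
      by (rule sum.cong) (auto simp: q_def inner_diff_left a_i power2_eq_square algebra_simps)
    ultimately have "2 * (1 - s) * s = 0"
      by (simp add: s_def coord_sqnorm_def sum_distrib_left)
    then show "coord_sqnorm D p = 1 \<or> coord_sqnorm D p = 0" by (auto simp: s_def)
  next
    assume "coord_sqnorm D p = 1 \<or> coord_sqnorm D p = 0"
    then have "(\<forall>x\<in>sphere 0 1. coord_sqnorm D x \<le> coord_sqnorm D p)
        \<or> (\<forall>x\<in>sphere 0 1. coord_sqnorm D p \<le> coord_sqnorm D x)"
      using le1 coord_sqnorm_nonneg[of D] by auto
    then show "p \<in> critical_set (sphere 0 1) (coord_sqnorm D)"
      using p smooth_on_coord_sqnorm[of D]
      by (intro extremum_in_critical_set) (auto simp: smooth_function_on_def)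
  qed
  moreover have "critical_set (sphere 0 1) (coord_sqnorm D) \<subseteq> sphere 0 1"
    by (auto simp: critical_set_def)
  ultimately show ?thesis
    using coord_sqnorm_eq_0_iff[OF D] coord_sqnorm_eq_1_iff[OF D] by (auto 4 4)
qed

section \<open>The lower bound\<close>

text \<open>
  A single member would contain a maximum and a minimum of \<open>g\<close>, hence \<open>g\<close> would be constant and the
  member the whole sphere, of the wrong dimension. The bound \<open>2\<close> makes the sphere in \<open>'a\<close> connected;
  on \<open>S\<^sup>0\<close>, a pair of points, maximum and minimum can share one member.
\<close>

lemma P_function_two_members:
  assumes P: "P_function (sphere (0::'a::euclidean_space) 1) (sphere (0::'b::euclidean_space) 1) g \<D>"
    and "DIM('a) \<ge> 2" "DIM('a) < DIM('b)"
  shows "\<exists>X\<in>\<D>. \<exists>Y\<in>\<D>. X \<noteq> Y"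
proof (rule ccontr)
  assume one: "\<not> ?thesis"
  let ?S = "sphere (0::'b) 1"
  have g: "smooth_function_on ?S g" and un: "\<Union>\<D> = critical_set ?S g"
    using P by (auto simp: P_function_def)
  have cont: "continuous_on ?S g" by (rule smooth_function_on_imp_continuous_on[OF g])
  obtain p where p: "p \<in> ?S" "\<forall>x\<in>?S. g x \<le> g p"
    using continuous_attains_sup[OF compact_sphere _ cont] by auto
  obtain q where q: "q \<in> ?S" "\<forall>x\<in>?S. g q \<le> g x"
    using continuous_attains_inf[OF compact_sphere _ cont] by auto
  have crit: "p \<in> critical_set ?S g" "q \<in> critical_set ?S g"
    using extremum_in_critical_set[OF g] p q by auto
  then obtain X where "X \<in> \<D>" using un by blast
  then have "\<D> = {X}" using one by blast
  then have X: "X = critical_set ?S g" using un by simp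
  obtain k where k: "smooth_submanifold k X" and hom: "X homeomorphic sphere (0::'a) 1"
    using P \<open>X \<in> \<D>\<close> unfolding P_function_def by blast
  have "connected X"
    using homeomorphic_connectedness[OF hom] connected_sphere[OF assms(2)] by blast
  then have "g constant_on X"
    using constant_on_connected_critical_submanifold[OF k] X by blast
  then have "g p = g q" using crit X unfolding constant_on_def by auto
  then have const: "g x = g p" if "x \<in> ?S" for x
    using bspec[OF p(2) that] bspec[OF q(2) that] by simp
  have "?S \<subseteq> critical_set ?S g"
    by (intro subsetI extremum_in_critical_set[OF g]) (simp_all add: const)
  then have "X = ?S" using X by (auto simp: critical_set_def)
  with hom obtain h h' where "homeomorphism ?S (sphere (0::'a) 1) h h'"
    unfolding homeomorphic_def by blast
  then have h: "continuous_on ?S h" "inj_on h ?S"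
    using homeomorphism_cont1 homeomorphism_apply1 by (blast intro: inj_on_inverseI)+
  have "DIM('b) \<le> DIM('a)" by (rule no_embedding_sphere_lowdim[OF h zero_less_one])
  with assms(3) show False by simp
qed

theorem theorem2p17:
  fixes n :: nat
  assumes "n \<ge> 1"
    and "DIM('a::euclidean_space) = n + 1"
    and "DIM('b::euclidean_space) = (2 * n + 1) + 1"
  shows "\<exists>(f :: 'b \<Rightarrow> real) \<C>.
    exact_P_function (sphere (0::'a) 1) (sphere (0::'b) 1) f \<C> \<and> card \<C> = 2"
proof -
  let ?S = "sphere (0::'b) 1" and ?P = "sphere (0::'a) 1"
  obtain D where D: "D \<subseteq> (Basis::'b set)" "card D = n + 1"
    using obtain_subset_with_card_n[of "n + 1" "Basis::'b set"] assms(3) by auto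
  have "card (Basis - D) = n + 1"
    using D assms(3) by (subst card_Diff_subset) (auto intro: finite_subset)
  define A where "A = ?S \<inter> coord_subspace D"
  define B where "B = ?S \<inter> coord_subspace (Basis - D)"
  let ?f = "coord_sqnorm D"
  have sub: "subspace (coord_subspace E)" for E :: "'b set"
    unfolding coord_subspace_def by (rule subspace_substandard)
  have dim: "dim (coord_subspace D) = DIM('a)" "dim (coord_subspace (Basis - D)) = DIM('a)"
    unfolding coord_subspace_def using D \<open>card (Basis - D) = n + 1\<close> assms(2)
    by (simp_all only: dim_substandard Diff_subset)
  have homAB: "A homeomorphic ?P" "B homeomorphic ?P"
    unfolding A_def B_def by (intro homeomorphic_sphere_section sub dim)+
  have smAB: "\<exists>k. smooth_submanifold k A" "\<exists>k. smooth_submanifold k B"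
    unfolding A_def B_def using smooth_submanifold_sphere_section[OF sub] by blast+
  have fA: "?f x = 1" if "x \<in> A" for x
    using that coord_sqnorm_eq_1_iff[OF D(1), of x] by (simp add: A_def)
  have fB: "?f x = 0" if "x \<in> B" for x
    using that coord_sqnorm_eq_0_iff[OF D(1), of x] by (simp add: B_def)
  have crit: "critical_set ?S ?f = A \<union> B"
    unfolding A_def B_def by (rule critical_set_coord_sqnorm[OF D(1)])
  have disj: "A \<inter> B = {}" using fA fB by fastforce
  have "?P \<noteq> {}" by simp
  then have "A \<noteq> {}" using homAB(1) homeomorphic_empty(2) by metis
  with disj have "A \<noteq> B" by auto
  have contf: "continuous_on (A \<union> B) ?f"
    using smooth_on_coord_sqnorm[of D] unfolding smooth_on_def
    by (metis Ck_on.simps(1) continuous_on_subset subset_UNIV)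
  \<comment> \<open>The value \<open>1/2\<close> separates the two critical levels.\<close>
  have "openin (top_of_set (A \<union> B)) ((A \<union> B) \<inter> ?f -` {1/2<..})"
    "openin (top_of_set (A \<union> B)) ((A \<union> B) \<inter> ?f -` {..<1/2})"
    by (intro continuous_openin_preimage_gen[OF contf] open_greaterThan open_lessThan)+
  moreover have "(A \<union> B) \<inter> ?f -` {1/2<..} = A" "(A \<union> B) \<inter> ?f -` {..<1/2} = B"
    using fA fB by (auto simp: vimage_def)
  ultimately have openAB: "openin (top_of_set (A \<union> B)) A" "openin (top_of_set (A \<union> B)) B"
    by simp_all
  have "smooth_function_on ?S ?f"
    using smooth_on_coord_sqnorm[of D] by (auto simp: smooth_function_on_def)
  then have P: "P_function ?P ?S ?f {A, B}"
    unfolding P_function_def crit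
    using disj homAB smAB openAB by (auto simp: disjoint_def)
  have "{A, B} \<lesssim> \<D>" if P\<D>: "P_function ?P ?S g \<D>" for g \<D>
  proof -
    obtain X Y where "X \<in> \<D>" "Y \<in> \<D>" "X \<noteq> Y"
      using P_function_two_members[OF P\<D>] assms by fastforce
    then show ?thesis
      unfolding lepoll_def
      by (intro exI[of _ "\<lambda>C. if C = A then X else Y"]) (auto simp: inj_on_def)
  qed
  with P have "exact_P_function ?P ?S ?f {A, B}" by (auto simp: exact_P_function_def)
  moreover have "card {A, B} = 2" using \<open>A \<noteq> B\<close> by simp
  ultimately show ?thesis by blast
qed

end
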